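(* Let $M\subset\mathbb{R}^n$ be a weak $r$-helix submanifold with respect to the directions $d_1,\dots,d_r\in\mathbb{R}^n$. For $j\in\{1,\dots,r\}$ let $T_j$ be the unit tangent component of $d_j$ along $M$, and let $\alpha_j$ be a unit speed integral curve of $T_j$ in $M$, with first curvature $k_j$. Then the normal curvature of $\alpha_j$ equals $|k_j|$, i.e. $\|V(T_j,T_j)\|=|k_j|$ along $\alpha_j$, where $V$ is the second fundamental form of $M$.
   Context: All submanifolds, curves and vector fields are smooth; $\mathbb{R}^n$ has its Euclidean metric, with standard covariant derivative $D$. A submanifold $M\subset\mathbb{R}^n$ is a helix with respect to a unit vector $d\in\mathbb{R}^n$ if the angle $\theta$ between $d$ and $T_qM$ is the same for all $q\in M$; it is assumed that $0<\theta<\pi/2$. Then along $M$ one has $d=\cos(\theta)\,T+\sin(\theta)\,\xi$ with $T$ a unit tangent vector field of $M$ (the unit tangent component of $d$) and $\xi$ a unit normal vector field of $M$ (the normal component of $d$). $M$ is a weak $r$-helix with respect to $d_1,\dots,d_r$ if these are $r$ linearly independent unit vectors and $M$ is a helix with respect to every $d_j$; write $d_j=\cos(\theta_j)T_j+\sin(\theta_j)\xi_j$. For tangent fields $X,Y$ of $M$, the Gauss equation $D_XY=\nabla_XY+V(X,Y)$ decomposes $D_XY$ into its tangential part $\nabla_XY$ ($\nabla$ the Riemannian connection of $M$) and normal part $V(X,Y)$ (second fundamental form). The normal curvature of a unit speed curve in $M$ with unit tangent $T$ is $\|V(T,T)\|$. The first curvature of a unit speed curve is its first Frenet curvature as a curve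 in $\mathbb{R}^n$. *)

theory Defs
  imports "HOL-Analysis.Analysis"
begin

subsection \<open>Smooth maps and embedded submanifolds\<close>

text \<open>These two predicates are only meant for open \<open>S\<close>.\<close>

primrec Ck_on :: "nat \<Rightarrow> ('a::euclidean_space \<Rightarrow> 'b::euclidean_space) \<Rightarrow> 'a set \<Rightarrow> bool" where
  "Ck_on 0 f S \<longleftrightarrow> continuous_on S f"
| "Ck_on (Suc k) f S \<longleftrightarrow>
     (\<forall>x\<in>S. f differentiable (at x)) \<and> (\<forall>v. Ck_on k (\<lambda>x. frechet_derivative f (at x) v) S)"

definition smooth_on :: "('a::euclidean_space \<Rightarrow> 'b::euclidean_space) \<Rightarrow> 'a set \<Rightarrow> bool" where
  "smooth_on f S \<longleftrightarrow> (\<forall>k. Ck_on k f S)"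

definition diffeomorphism_between ::
  "'a::euclidean_space set \<Rightarrow> 'a set \<Rightarrow> ('a \<Rightarrow> 'a) \<Rightarrow> ('a \<Rightarrow> 'a) \<Rightarrow> bool" where
  "diffeomorphism_between U V \<phi> \<psi> \<longleftrightarrow>
     open U \<and> open V \<and> smooth_on \<phi> U \<and> smooth_on \<psi> V \<and> \<phi> ` U = V \<and> \<psi> ` V = U \<and>
     (\<forall>x\<in>U. \<psi> (\<phi> x) = x) \<and> (\<forall>y\<in>V. \<phi> (\<psi> y) = y)"

text \<open>Embedded \<open>m\<close>-dimensional submanifolds, by slice charts: near each of its points
  \<open>M\<close> is straightened to an \<open>m\<close>-dimensional linear subspace.\<close>

definition smooth_submanifold :: "nat \<Rightarrow> 'a::euclidean_space set \<Rightarrow> bool" where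
  "smooth_submanifold m M \<longleftrightarrow>
     (\<forall>p\<in>M. \<exists>U V \<phi> \<psi> L. p \<in> U \<and> diffeomorphism_between U V \<phi> \<psi> \<and>
        subspace L \<and> dim L = m \<and> \<phi> ` (U \<inter> M) = V \<inter> L)"

definition tangent_space :: "'a::euclidean_space set \<Rightarrow> 'a \<Rightarrow> 'a set" where
  "tangent_space M q =
     {v. \<exists>\<gamma> e. 0 < e \<and> smooth_on \<gamma> {-e<..<e} \<and> \<gamma> ` {-e<..<e} \<subseteq> M \<and> \<gamma> 0 = q \<and>
           (\<gamma> has_vector_derivative v) (at 0)}"

definition tangent_part :: "'a::euclidean_space set \<Rightarrow> 'a \<Rightarrow> 'a \<Rightarrow> 'a" where
  "tangent_part M q v =
     (THE y. y \<in> tangent_space M q \<and> (\<forall>w\<in>tangent_space M q. orthogonal (v - y) w))"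

subsection \<open>Covariant derivative and second fundamental form\<close>

text \<open>The derivative of \<open>Y\<close> within \<open>M\<close> is not unique as a linear map on the
  ambient space, but its values on tangent vectors of \<open>M\<close> are; lemma
  \<open>covariant_deriv_eq_extension\<close> below identifies them with the usual \<open>D\<^sub>XY\<close>,
  computed with any extension of \<open>Y\<close>.\<close>

definition covariant_deriv ::
  "'a::euclidean_space set \<Rightarrow> ('a \<Rightarrow> 'a) \<Rightarrow> ('a \<Rightarrow> 'a) \<Rightarrow> 'a \<Rightarrow> 'a" where
  "covariant_deriv M X Y p = frechet_derivative Y (at p within M) (X p)"

lemma has_vector_derivative_along_curve:
  fixes Y :: "'a::euclidean_space \<Rightarrow> 'a"
  assumes "0 < e" "\<gamma> ` {-e<..<e} \<subseteq> M" "\<gamma> 0 = p" "(\<gamma> has_vector_derivative v) (at 0)"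
    and Y: "(Y has_derivative A) (at p within M)"
  shows "((Y \<circ> \<gamma>) has_vector_derivative A v) (at 0)"
proof -
  let ?I = "{-e<..<e}"
  have g: "(\<gamma> has_derivative (\<lambda>t. t *\<^sub>R v)) (at 0 within ?I)"
    using assms(4) by (simp add: has_vector_derivative_def has_derivative_at_withinI)
  have "(Y has_derivative A) (at (\<gamma> 0) within \<gamma> ` ?I)"
    using Y assms(2,3) by (auto intro: has_derivative_subset)
  from diff_chain_within[OF g this]
  have "((Y \<circ> \<gamma>) has_derivative (\<lambda>t. A (t *\<^sub>R v))) (at 0 within ?I)"
    by (simp add: o_def)
  moreover have "(\<lambda>t. A (t *\<^sub>R v)) = (\<lambda>t. t *\<^sub>R A v)"
    using linear_scale[OF has_derivative_linear[OF Y]] by auto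
  ultimately show ?thesis
    using assms(1) by (simp add: has_vector_derivative_def at_within_open[of 0 ?I])
qed

lemma covariant_deriv_eq_extension:
  fixes Y Z :: "'a::euclidean_space \<Rightarrow> 'a"
  assumes "p \<in> M" "open U" "p \<in> U" and Z: "Z differentiable (at p)"
    and eq: "\<And>q. q \<in> U \<inter> M \<Longrightarrow> Y q = Z q" and X: "X p \<in> tangent_space M p"
  shows "covariant_deriv M X Y p = frechet_derivative Z (at p) (X p)"
proof -
  have 1: "(Z has_derivative frechet_derivative Z (at p)) (at p within M)"
    using Z frechet_derivative_works has_derivative_at_withinI by blast
  have Y1: "(Y has_derivative frechet_derivative Z (at p)) (at p within M)"
  proof (rule has_derivative_transform_eventually[OF 1])
    show "\<forall>\<^sub>F x in at p within M. Z x = Y x"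
      using assms(2,3) eq by (auto simp: eventually_at_topological)
  qed (use assms in auto)
  hence Y2: "(Y has_derivative frechet_derivative Y (at p within M)) (at p within M)"
    using frechet_derivative_works differentiable_def by blast
  show ?thesis
    using X vector_derivative_unique_at has_vector_derivative_along_curve[OF _ _ _ _ Y1]
      has_vector_derivative_along_curve[OF _ _ _ _ Y2]
    unfolding tangent_space_def covariant_deriv_def by blast
qed

definition riemannian_connection ::
  "'a::euclidean_space set \<Rightarrow> ('a \<Rightarrow> 'a) \<Rightarrow> ('a \<Rightarrow> 'a) \<Rightarrow> 'a \<Rightarrow> 'a" where
  "riemannian_connection M X Y p = tangent_part M p (covariant_deriv M X Y p)"

definition second_fundamental_form ::
  "'a::euclidean_space set \<Rightarrow> ('a \<Rightarrow> 'a) \<Rightarrow> ('a \<Rightarrow> 'a) \<Rightarrow> 'a \<Rightarrow> 'a" where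
  "second_fundamental_form M X Y p = covariant_deriv M X Y p - riemannian_connection M X Y p"

subsection \<open>Helix submanifolds\<close>

text \<open>The angle between \<open>d\<close> and its orthogonal projection to the tangent space
  (\<open>\<pi>/2\<close> if that projection vanishes, as \<open>x / 0 = 0\<close>).\<close>

definition angle_with_tangent_space :: "'a::euclidean_space set \<Rightarrow> 'a \<Rightarrow> 'a \<Rightarrow> real" where
  "angle_with_tangent_space M q d =
     arccos (d \<bullet> tangent_part M q d / (norm d * norm (tangent_part M q d)))"

definition helix :: "'a::euclidean_space set \<Rightarrow> 'a \<Rightarrow> bool" where
  "helix M d \<longleftrightarrow> norm d = 1 \<and>
     (\<exists>\<theta>. 0 < \<theta> \<and> \<theta> < pi / 2 \<and> (\<forall>q\<in>M. angle_with_tangent_space M q d = \<theta>))"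

definition weak_helix :: "nat \<Rightarrow> 'a::euclidean_space set \<Rightarrow> (nat \<Rightarrow> 'a) \<Rightarrow> bool" where
  "weak_helix r M d \<longleftrightarrow>
     inj_on d {1..r} \<and> independent (d ` {1..r}) \<and> (\<forall>j\<in>{1..r}. helix M (d j))"

definition unit_tangent_component :: "'a::euclidean_space set \<Rightarrow> 'a \<Rightarrow> 'a \<Rightarrow> 'a" where
  "unit_tangent_component M d q = tangent_part M q d /\<^sub>R norm (tangent_part M q d)"

subsection \<open>Curves\<close>

definition integral_curve ::
  "'a::euclidean_space set \<Rightarrow> ('a \<Rightarrow> 'a) \<Rightarrow> real set \<Rightarrow> (real \<Rightarrow> 'a) \<Rightarrow> bool" where
  "integral_curve M X I \<alpha> \<longleftrightarrow>
     open I \<and> is_interval I \<and> smooth_on \<alpha> I \<and>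
     (\<forall>s\<in>I. \<alpha> s \<in> M \<and> (\<alpha> has_vector_derivative X (\<alpha> s)) (at s))"

definition unit_speed :: "real set \<Rightarrow> (real \<Rightarrow> 'a::euclidean_space) \<Rightarrow> bool" where
  "unit_speed I \<alpha> \<longleftrightarrow> (\<forall>s\<in>I. norm (vector_derivative \<alpha> (at s)) = 1)"

text \<open>First Frenet equation \<open>\<alpha>'' = k N\<close> of a unit speed curve, with a unit field \<open>N\<close>
  orthogonal to \<open>\<alpha>'\<close>. The sign of \<open>k\<close> is left free, so that both \<open>k = \<parallel>\<alpha>''\<parallel>\<close> and a
  signed curvature (as for plane curves) are allowed; where \<open>\<alpha>'' = 0\<close>, the choice of
  \<open>N\<close> is arbitrary and \<open>k = 0\<close>.\<close>

definition first_curvature ::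
  "real set \<Rightarrow> (real \<Rightarrow> 'a::euclidean_space) \<Rightarrow> (real \<Rightarrow> real) \<Rightarrow> bool" where
  "first_curvature I \<alpha> k \<longleftrightarrow>
     (\<exists>N. \<forall>s\<in>I. norm (N s) = 1 \<and> orthogonal (N s) (vector_derivative \<alpha> (at s)) \<and>
        ((\<lambda>t. vector_derivative \<alpha> (at t)) has_vector_derivative k s *\<^sub>R N s) (at s))"

end

theory Submission
  imports Defs
begin

text \<open>Let \<open>P q\<close> be the tangential part of \<open>d = d\<^sub>j\<close> at \<open>q\<close>. The helix condition says that
\<open>\<parallel>P\<parallel>\<close> is a constant \<open>c = cos \<theta> > 0\<close> along \<open>M\<close>, so \<open>T = P / c\<close>. Since \<open>P\<close> is the gradient on \<open>M\<close>
of the height function \<open>x \<mapsto> d \<bullet> x\<close>, the claim is an instance of the fact that integral curves of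
a gradient field of constant length are geodesics: then \<open>\<alpha>''\<close> is normal to \<open>M\<close>, and the Gauss
equation leaves \<open>V(T, T) = D\<^sub>T T = \<alpha>'' = k N\<close> along \<open>\<alpha>\<close>, of norm \<open>\<bar>k\<bar>\<close>.

The geodesic property is computed in a local parametrization \<open>\<psi>\<close> of \<open>M\<close> over a linear
subspace \<open>L\<close>. Write \<open>\<alpha> = \<psi> \<circ> y\<close> and let \<open>h = y'(s)\<close>.

\<^item> For \<open>w \<in> L\<close> the identity \<open>c (\<alpha>' \<bullet> D\<psi> w) = d \<bullet> D\<psi> w\<close> holds all along \<open>\<alpha>\<close>. Its derivative gives
  \<open>c (\<alpha>'' \<bullet> D\<psi> w) = (d - c \<alpha>') \<bullet> D\<^sup>2\<psi>(h, w)\<close> (lemma \<open>acceleration_normal\<close>).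

\<^item> Every tangent vector satisfies \<open>(d \<bullet> v)\<^sup>2 \<le> c\<^sup>2 \<parallel>v\<parallel>\<^sup>2\<close> by the Cauchy-Schwarz inequality, with equality at
  \<open>v = \<alpha>'\<close>. So \<open>z \<mapsto> c\<^sup>2 \<parallel>D\<psi>(z) h\<parallel>\<^sup>2 - (d \<bullet> D\<psi>(z) h)\<^sup>2\<close> has a minimum along \<open>L\<close> at the foot
  point, and its vanishing derivative says \<open>(d - c \<alpha>') \<bullet> D\<^sup>2\<psi>(w, h) = 0\<close>
  (lemma \<open>directional_derivative_at_optimal_direction\<close>).

\<^item> The two second derivatives agree by the symmetry of \<open>D\<^sup>2\<psi>\<close>
  (lemma \<open>frechet_derivative_symmetric\<close>), hence \<open>\<alpha>'' \<bullet> D\<psi> w = 0\<close>.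

The covariant derivative of \<open>T\<close> is the derivative along \<open>\<alpha>\<close> only once \<open>T\<close> is known to be differentiable
within \<open>M\<close>. This comes from orthogonal projection onto the span of a differentiable
frame (lemma \<open>differentiable_projection_onto_span\<close>).\<close>

section \<open>Smooth maps and their derivatives\<close>

lemma smooth_on_has_derivative:
  assumes "smooth_on f S" "x \<in> S"
  shows "(f has_derivative frechet_derivative f (at x)) (at x)"
proof -
  have "Ck_on (Suc 0) f S" using assms(1) unfolding smooth_on_def by blast
  then show ?thesis using assms(2) by (simp add: frechet_derivative_works)
qed

lemma smooth_on_directional_derivative:
  assumes "smooth_on f S"
  shows "smooth_on (\<lambda>x. frechet_derivative f (at x) v) S"
proof -
  have "Ck_on (Suc k) f S" for k using assms unfolding smooth_on_def by blast
  then show ?thesis unfolding smooth_on_def by simp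
qed

lemma smooth_on_imp_continuous_on:
  assumes "smooth_on f S" shows "continuous_on S f"
  using assms unfolding smooth_on_def by (metis Ck_on.simps(1))

lemma Ck_on_cong:
  assumes "open S" "\<And>x. x \<in> S \<Longrightarrow> f x = g x" "Ck_on k f S"
  shows "Ck_on k g S"
  using assms(2,3)
proof (induction k arbitrary: f g)
  case 0
  then show ?case by (metis Ck_on.simps(1) continuous_on_cong)
next
  case (Suc k)
  have "g differentiable (at x)" if "x \<in> S" for x
    using Suc.prems that assms(1)
    by (metis Ck_on.simps(2) differentiable_def has_derivative_transform_within_open)
  moreover have "Ck_on k (\<lambda>x. frechet_derivative g (at x) v) S" for v
  proof (rule Suc.IH)
    show "Ck_on k (\<lambda>x. frechet_derivative f (at x) v) S" using Suc.prems(2) by simp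
    show "frechet_derivative f (at x) v = frechet_derivative g (at x) v" if "x \<in> S" for x
      using frechet_derivative_transform_within_open[of f x S g] Suc.prems that assms(1) by simp
  qed
  ultimately show ?case by simp
qed

text \<open>Restriction to a line. The induction over the order of differentiability stays within the statement,
because the derivative of the restriction in direction \<open>v\<close> is the restriction of the directional
derivative of \<open>f\<close> along \<open>v *\<^sub>R w\<close>, which is again smooth.\<close>

lemma smooth_on_line:
  fixes f :: "'a::euclidean_space \<Rightarrow> 'b::euclidean_space" and J :: "real set"
  assumes "smooth_on f S" "open J" "\<And>t. t \<in> J \<Longrightarrow> y + t *\<^sub>R w \<in> S"
  shows "smooth_on (\<lambda>t. f (y + t *\<^sub>R w)) J"
proof -
  have "Ck_on k (\<lambda>t. f (y + t *\<^sub>R w)) J" if "smooth_on f S" for k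
    using that
  proof (induction k arbitrary: f)
    case 0
    have "continuous_on J (f \<circ> (\<lambda>t. y + t *\<^sub>R w))"
      by (rule continuous_on_compose)
        (use assms(3) in \<open>auto intro!: continuous_intros
          continuous_on_subset[OF smooth_on_imp_continuous_on[OF 0]]\<close>)
    then show ?case by (simp add: o_def)
  next
    case (Suc k)
    have D: "((\<lambda>t. f (y + t *\<^sub>R w)) has_derivative
        (\<lambda>v. frechet_derivative f (at (y + t *\<^sub>R w)) (v *\<^sub>R w))) (at t)" if "t \<in> J" for t
      by (rule has_derivative_compose[where g=f and f="\<lambda>t. y + t *\<^sub>R w"])
        (auto intro!: derivative_eq_intros smooth_on_has_derivative[OF Suc.prems] assms(3) that)
    have "Ck_on k (\<lambda>t. frechet_derivative (\<lambda>t. f (y + t *\<^sub>R w)) (at t) v) J" for v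
    proof (rule Ck_on_cong[OF assms(2)])
      show "Ck_on k (\<lambda>t. frechet_derivative f (at (y + t *\<^sub>R w)) (v *\<^sub>R w)) J"
        by (rule Suc.IH[OF smooth_on_directional_derivative[OF Suc.prems]])
      show "frechet_derivative f (at (y + t *\<^sub>R w)) (v *\<^sub>R w) =
          frechet_derivative (\<lambda>t. f (y + t *\<^sub>R w)) (at t) v" if "t \<in> J" for t
        using frechet_derivative_at[OF D[OF that]] by metis
    qed
    moreover have "(\<lambda>t. f (y + t *\<^sub>R w)) differentiable (at t)" if "t \<in> J" for t
      using D[OF that] differentiableI by blast
    ultimately show ?case by simp
  qed
  then show ?thesis using assms(1) unfolding smooth_on_def by blast
qed

section \<open>Symmetry of the second derivative\<close>

text \<open>The second difference of \<open>f\<close> over the parallelogram spanned by \<open>h v\<close> and \<open>h w\<close> is a difference in the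
direction \<open>w\<close> of differences in the direction \<open>v\<close>; the mean value theorem applied to each in turn produces
an iterated derivative. The left-hand side does not change when \<open>v\<close> and \<open>w\<close> are exchanged, which is what
makes mixed derivatives agree in the limit \<open>h \<longrightarrow> 0\<close>.\<close>

lemma second_difference_eq:
  fixes f :: "'a::real_normed_vector \<Rightarrow> real"
  assumes A: "\<And>z. z \<in> ball y r \<Longrightarrow> (f has_derivative A z) (at z)"
    and B: "\<And>z. z \<in> ball y r \<Longrightarrow> ((\<lambda>x. A x v) has_derivative B z) (at z)"
    and h: "0 < h" "h * (norm v + norm w) < r"
  shows "\<exists>z. dist y z \<le> h * (norm v + norm w) \<and>
    f (y + h *\<^sub>R v + h *\<^sub>R w) - f (y + h *\<^sub>R v) - f (y + h *\<^sub>R w) + f y = h\<^sup>2 * B z w"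
proof -
  have dist: "dist y (y + s *\<^sub>R v + t *\<^sub>R w) \<le> h * (norm v + norm w)"
    if "0 \<le> s" "s \<le> h" "0 \<le> t" "t \<le> h" for s t
  proof -
    have "dist y (y + s *\<^sub>R v + t *\<^sub>R w) \<le> norm (s *\<^sub>R v) + norm (t *\<^sub>R w)"
      by (metis add.assoc add_diff_cancel_left' dist_commute dist_norm norm_triangle_ineq)
    also have "\<dots> \<le> h * norm v + h * norm w"
      using that by (auto intro!: add_mono mult_right_mono)
    finally show ?thesis by (simp add: algebra_simps)
  qed
  have ball: "y + s *\<^sub>R v + t *\<^sub>R w \<in> ball y r"
    if "0 \<le> s" "s \<le> h" "0 \<le> t" "t \<le> h" for s t
    using dist[OF that] h(2) by simp
  define \<phi> where "\<phi> s = f (y + s *\<^sub>R v + h *\<^sub>R w) - f (y + s *\<^sub>R v + 0 *\<^sub>R w)" for s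
  have fd: "((\<lambda>s. f (y + s *\<^sub>R v + t *\<^sub>R w)) has_real_derivative A (y + s *\<^sub>R v + t *\<^sub>R w) v) (at s)"
    if "0 \<le> s" "s \<le> h" "0 \<le> t" "t \<le> h" for s t
  proof -
    have "((\<lambda>s. f (y + s *\<^sub>R v + t *\<^sub>R w)) has_derivative
        (\<lambda>u. A (y + s *\<^sub>R v + t *\<^sub>R w) (u *\<^sub>R v))) (at s)"
      by (rule has_derivative_compose[where g=f and f="\<lambda>s. y + s *\<^sub>R v + t *\<^sub>R w"])
        (auto intro!: derivative_eq_intros A ball that)
    moreover have "(\<lambda>u. A (y + s *\<^sub>R v + t *\<^sub>R w) (u *\<^sub>R v)) = (*) (A (y + s *\<^sub>R v + t *\<^sub>R w) v)"
      using linear_scale[OF has_derivative_linear[OF A[OF ball[OF that]]]] by (auto simp: mult.commute)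
    ultimately show ?thesis by (simp add: has_field_derivative_def)
  qed
  have Ad: "((\<lambda>t. A (y + s *\<^sub>R v + t *\<^sub>R w) v) has_real_derivative B (y + s *\<^sub>R v + t *\<^sub>R w) w) (at t)"
    if "0 \<le> s" "s \<le> h" "0 \<le> t" "t \<le> h" for s t
  proof -
    have "((\<lambda>t. A (y + s *\<^sub>R v + t *\<^sub>R w) v) has_derivative
        (\<lambda>u. B (y + s *\<^sub>R v + t *\<^sub>R w) (u *\<^sub>R w))) (at t)"
      by (rule has_derivative_compose[where g="\<lambda>x. A x v" and f="\<lambda>t. y + s *\<^sub>R v + t *\<^sub>R w"])
        (auto intro!: derivative_eq_intros B ball that)
    moreover have "(\<lambda>u. B (y + s *\<^sub>R v + t *\<^sub>R w) (u *\<^sub>R w)) = (*) (B (y + s *\<^sub>R v + t *\<^sub>R w) w)"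
      using linear_scale[OF has_derivative_linear[OF B[OF ball[OF that]]]] by (auto simp: mult.commute)
    ultimately show ?thesis by (simp add: has_field_derivative_def)
  qed
  have "\<exists>s>0. s < h \<and> \<phi> h - \<phi> 0 = (h - 0) * (A (y + s *\<^sub>R v + h *\<^sub>R w) v - A (y + s *\<^sub>R v + 0 *\<^sub>R w) v)"
    unfolding \<phi>_def by (rule MVT2) (use h in \<open>auto intro!: DERIV_diff fd simp del: scale_zero_left\<close>)
  then obtain s where s: "0 < s" "s < h"
    "\<phi> h - \<phi> 0 = h * (A (y + s *\<^sub>R v + h *\<^sub>R w) v - A (y + s *\<^sub>R v + 0 *\<^sub>R w) v)" by auto
  have "\<exists>t>0. t < h \<and> A (y + s *\<^sub>R v + h *\<^sub>R w) v - A (y + s *\<^sub>R v + 0 *\<^sub>R w) v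
      = (h - 0) * B (y + s *\<^sub>R v + t *\<^sub>R w) w"
    by (rule MVT2) (use h s in \<open>auto intro!: Ad\<close>)
  then obtain t where t: "0 < t" "t < h" "A (y + s *\<^sub>R v + h *\<^sub>R w) v - A (y + s *\<^sub>R v + 0 *\<^sub>R w) v
      = h * B (y + s *\<^sub>R v + t *\<^sub>R w) w" by auto
  have "\<phi> h - \<phi> 0 = h\<^sup>2 * B (y + s *\<^sub>R v + t *\<^sub>R w) w"
    using s(3) t(3) by (simp add: power2_eq_square)
  then show ?thesis
    using dist[of s t] s t unfolding \<phi>_def by (auto simp: algebra_simps)
qed

lemma frechet_derivative_symmetric:
  fixes f :: "'a::euclidean_space \<Rightarrow> 'b::euclidean_space"
  assumes "open V" "smooth_on f V" "y \<in> V"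
  shows "frechet_derivative (\<lambda>z. frechet_derivative f (at z) v) (at y) w =
    frechet_derivative (\<lambda>z. frechet_derivative f (at z) w) (at y) v"
proof -
  define B where "B v w z = frechet_derivative (\<lambda>z. frechet_derivative f (at z) v) (at z) w" for v w z
  \<comment> \<open>The mean value theorem is scalar, so the values are compared through their inner products.\<close>
  have "B v w y \<bullet> n = B w v y \<bullet> n" for n
  proof (rule ccontr)
    assume neq: "B v w y \<bullet> n \<noteq> B w v y \<bullet> n"
    \<comment> \<open>Both mixed derivatives agree at points arbitrarily near \<open>y\<close>, but stay within \<open>\<epsilon>\<close> of values that are \<open>2 \<epsilon>\<close> apart.\<close>
    define \<epsilon> where "\<epsilon> = \<bar>B v w y \<bullet> n - B w v y \<bullet> n\<bar> / 2"
    have "\<epsilon> > 0" using neq by (simp add: \<epsilon>_def)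
    have "continuous_on V (\<lambda>z. B a b z \<bullet> n)" for a b
      unfolding B_def using assms(2)
      by (intro continuous_intros smooth_on_imp_continuous_on smooth_on_directional_derivative)
    then have "\<exists>r>0. \<forall>z\<in>V. dist z y < r \<longrightarrow> dist (B a b z \<bullet> n) (B a b y \<bullet> n) < \<epsilon>" for a b
      using \<open>\<epsilon> > 0\<close> assms(3) unfolding continuous_on_iff by blast
    then obtain r1 r2 where r1: "r1 > 0" "\<And>z. z \<in> V \<Longrightarrow> dist z y < r1 \<Longrightarrow> \<bar>B v w z \<bullet> n - B v w y \<bullet> n\<bar> < \<epsilon>"
      and r2: "r2 > 0" "\<And>z. z \<in> V \<Longrightarrow> dist z y < r2 \<Longrightarrow> \<bar>B w v z \<bullet> n - B w v y \<bullet> n\<bar> < \<epsilon>"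
      unfolding dist_real_def by meson
    obtain r3 where r3: "r3 > 0" "ball y r3 \<subseteq> V" using assms(1,3) openE by blast
    define r where "r = min r1 (min r2 r3)"
    have r: "r > 0" "ball y r \<subseteq> V" "r \<le> r1" "r \<le> r2" using r1 r2 r3 by (auto simp: r_def)
    define h where "h = r / (norm v + norm w + 1)"
    have N: "norm v + norm w + 1 > 0" by (smt (verit) norm_ge_zero)
    have h: "h > 0" "h * (norm v + norm w) < r" "h * (norm w + norm v) < r"
      using r(1) N by (auto simp: h_def field_simps)
    have 1: "((\<lambda>z. f z \<bullet> n) has_derivative (\<lambda>u. frechet_derivative f (at z) u \<bullet> n)) (at z)"
      if "z \<in> ball y r" for z
      using that r(2) by (intro has_derivative_inner_left smooth_on_has_derivative[OF assms(2)]) auto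
    have 2: "((\<lambda>z. frechet_derivative f (at z) a \<bullet> n) has_derivative (\<lambda>b. B a b z \<bullet> n)) (at z)"
      if "z \<in> ball y r" for z a
      unfolding B_def using that r(2)
      by (intro has_derivative_inner_left smooth_on_has_derivative[where S=V]
            smooth_on_directional_derivative[OF assms(2)]) auto
    have D: "\<exists>z. dist y z \<le> h * (norm a + norm b) \<and>
        f (y + h *\<^sub>R a + h *\<^sub>R b) \<bullet> n - f (y + h *\<^sub>R a) \<bullet> n - f (y + h *\<^sub>R b) \<bullet> n + f y \<bullet> n
        = h\<^sup>2 * (B a b z \<bullet> n)" if "h * (norm a + norm b) < r" for a b
      by (rule second_difference_eq[where f="\<lambda>z. f z \<bullet> n" and
            A="\<lambda>z u. frechet_derivative f (at z) u \<bullet> n", OF 1 2 h(1) that])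
    obtain z1 where z1: "dist y z1 \<le> h * (norm v + norm w)"
      "f (y + h *\<^sub>R v + h *\<^sub>R w) \<bullet> n - f (y + h *\<^sub>R v) \<bullet> n - f (y + h *\<^sub>R w) \<bullet> n + f y \<bullet> n = h\<^sup>2 * (B v w z1 \<bullet> n)"
      using D[OF h(2)] by (elim exE conjE) (rule that)
    obtain z2 where z2: "dist y z2 \<le> h * (norm w + norm v)"
      "f (y + h *\<^sub>R w + h *\<^sub>R v) \<bullet> n - f (y + h *\<^sub>R w) \<bullet> n - f (y + h *\<^sub>R v) \<bullet> n + f y \<bullet> n = h\<^sup>2 * (B w v z2 \<bullet> n)"
      using D[OF h(3)] by (elim exE conjE) (rule that)
    have "h\<^sup>2 * (B v w z1 \<bullet> n) = h\<^sup>2 * (B w v z2 \<bullet> n)"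
      using z1(2) z2(2) by (simp add: algebra_simps)
    then have eq: "B v w z1 \<bullet> n = B w v z2 \<bullet> n" using h(1) by simp
    have "dist z1 y < r" "dist z2 y < r"
      using z1(1) z2(1) h by (auto simp: dist_commute)
    then have "\<bar>B v w z1 \<bullet> n - B v w y \<bullet> n\<bar> < \<epsilon>" "\<bar>B w v z2 \<bullet> n - B w v y \<bullet> n\<bar> < \<epsilon>"
      using r by (auto intro!: r1(2) r2(2) simp: subset_eq dist_commute)
    then show False using eq unfolding \<epsilon>_def by argo
  qed
  then have "B v w y = B w v y" by (rule euclidean_eqI)
  then show ?thesis by (simp add: B_def)
qed

section \<open>Orthogonal projections\<close>

text \<open>The orthogonal projection onto the span of a moving frame depends differentiably on the parameter. This is
Gram-Schmidt orthogonalization: adding one vector to the frame adds the projection onto its component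
\<open>u\<close> orthogonal to the previous ones, which involves division by \<open>u \<bullet> u\<close>. The frame is
independent at \<open>y\<close>, so \<open>u y \<noteq> 0\<close> and the quotient is differentiable there; at parameters where
\<open>u\<close> vanishes the value \<open>0\<close> of the quotient still gives the right projection.\<close>

lemma differentiable_projection_onto_span:
  fixes A :: "'b::real_normed_vector \<Rightarrow> 'a::euclidean_space \<Rightarrow> 'c::euclidean_space"
  assumes "finite S" "independent S" "linear (A y)" "inj (A y)"
    and "\<And>b. b \<in> S \<Longrightarrow> (\<lambda>z. A z b) differentiable (at y)"
    and "g differentiable (at y)"
  shows "\<exists>G. G differentiable (at y) \<and>
    (\<forall>z. G z \<in> span (A z ` S) \<and> (\<forall>b\<in>S. orthogonal (g z - G z) (A z b)))"
  using assms(1,2,5,6)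
proof (induction S arbitrary: g rule: finite_induct)
  case empty
  then show ?case by (intro exI[of _ "\<lambda>_. 0"]) auto
next
  case (insert b S)
  have ind: "independent S" "b \<notin> span S"
    using insert.prems(1) insert.hyps independent_insert[of b S] by auto
  obtain E where E: "E differentiable (at y)" "\<And>z. E z \<in> span (A z ` S)"
    "\<And>z x. x \<in> S \<Longrightarrow> orthogonal (A z b - E z) (A z x)"
    using insert.IH[OF ind(1), of "\<lambda>z. A z b"] insert.prems(2) by auto
  obtain H where H: "H differentiable (at y)" "\<And>z. H z \<in> span (A z ` S)"
    "\<And>z x. x \<in> S \<Longrightarrow> orthogonal (g z - H z) (A z x)"
    using insert.IH[OF ind(1), of g] insert.prems(2,3) by auto
  \<comment> \<open>One Gram-Schmidt step: \<open>E\<close> projects the new frame vector, \<open>H\<close> projects \<open>g\<close>.\<close>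
  define u where "u z = A z b - E z" for z
  define G where "G z = H z + ((g z \<bullet> u z) / (u z \<bullet> u z)) *\<^sub>R u z" for z
  have u: "u differentiable (at y)"
    unfolding u_def using E(1) insert.prems(2) by (intro differentiable_diff) auto
  have "A y b \<notin> span (A y ` S)"
    using ind(2) assms(3,4) by (simp add: linear_span_image inj_image_mem_iff)
  then have "u y \<noteq> 0" using E(2)[of y] by (auto simp: u_def)
  then have "G differentiable (at y)"
    unfolding G_def using u H(1) insert.prems(3)
    by (intro differentiable_add differentiable_scaleR differentiable_divide differentiable_inner) auto
  moreover have "G z \<in> span (A z ` insert b S)" for z
  proof -
    have "E z \<in> span (A z ` insert b S)" "H z \<in> span (A z ` insert b S)"
      using E(2)[of z] H(2)[of z] span_mono[of "A z ` S" "A z ` insert b S"] by auto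
    then show ?thesis unfolding G_def u_def
      by (intro span_add span_scale span_diff span_base[of "A z b"]) auto
  qed
  moreover have "orthogonal (g z - G z) (A z x)" if "x \<in> insert b S" for z x
  proof -
    have uS: "orthogonal (u z) x'" if "x' \<in> span (A z ` S)" for x'
      using that E(3) orthogonal_to_span[of x' "A z ` S" "u z"] by (auto simp: u_def)
    have gS: "orthogonal (g z - H z) x'" if "x' \<in> span (A z ` S)" for x'
      using that H(3) orthogonal_to_span[of x' "A z ` S" "g z - H z"] by auto
    have GS: "orthogonal (g z - G z) x'" if "x' \<in> span (A z ` S)" for x'
      using uS[OF that] gS[OF that] by (simp add: G_def orthogonal_def algebra_simps)
    have "(g z - G z) \<bullet> u z = g z \<bullet> u z - H z \<bullet> u z - (g z \<bullet> u z) / (u z \<bullet> u z) * (u z \<bullet> u z)"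
      by (simp add: G_def algebra_simps)
    also have "\<dots> = 0"
      using uS[OF H(2)] by (simp add: orthogonal_def inner_commute)
    finally have "orthogonal (g z - G z) (u z + E z)"
      using GS[OF E(2)] by (simp add: orthogonal_def inner_add_right)
    then have "orthogonal (g z - G z) (A z b)" by (simp add: u_def)
    then show ?thesis using that GS span_base[of "A z x" "A z ` S"] by auto
  qed
  ultimately show ?case by blast
qed

lemma tangent_part_eqI:
  assumes "subspace (tangent_space M q)" "y \<in> tangent_space M q"
    "\<And>w. w \<in> tangent_space M q \<Longrightarrow> orthogonal (v - y) w"
  shows "tangent_part M q v = y"
  unfolding tangent_part_def
proof (rule the_equality)
  fix x assume x: "x \<in> tangent_space M q \<and> (\<forall>w\<in>tangent_space M q. orthogonal (v - x) w)"
  then have "x - y \<in> tangent_space M q" using assms(1,2) subspace_diff by blast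
  then have "orthogonal (v - x) (x - y)" "orthogonal (v - y) (x - y)" using x assms(3) by auto
  then have "(x - y) \<bullet> (x - y) = 0" by (simp add: orthogonal_def algebra_simps)
  then show "x = y" by simp
qed (use assms in auto)

lemma has_vector_derivative_in_subspace:
  fixes f :: "real \<Rightarrow> 'a::euclidean_space"
  assumes "(f has_vector_derivative v) (at t)" "subspace L" "\<forall>\<^sub>F s in at t. f s \<in> L" "f t \<in> L"
  shows "v \<in> L"
proof -
  obtain y z where yz: "y \<in> span L" "\<And>w. w \<in> span L \<Longrightarrow> orthogonal z w" "v = y + z"
    using orthogonal_subspace_decomp_exists by metis
  have zL: "0 = x \<bullet> z" if "x \<in> L" for x
    using yz(2)[OF span_base[OF that]] by (simp add: orthogonal_def inner_commute)
  have "((\<lambda>s. f s \<bullet> z) has_vector_derivative v \<bullet> z) (at t)"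
    using assms(1) bounded_linear.has_vector_derivative bounded_linear_inner_left by blast
  moreover have "((\<lambda>s. f s \<bullet> z) has_vector_derivative 0) (at t)"
    unfolding has_vector_derivative_def
  proof (rule has_derivative_transform_eventually)
    show "((\<lambda>_. 0) has_derivative (\<lambda>x. x *\<^sub>R (0::real))) (at t)" by simp
    show "\<forall>\<^sub>F s in at t. 0 = f s \<bullet> z"
      using assms(3) by eventually_elim (rule zL)
    show "0 = f t \<bullet> z" using assms(4) by (rule zL)
  qed simp
  ultimately have "v \<bullet> z = 0" using vector_derivative_unique_at by blast
  moreover have "y \<bullet> z = 0" using yz(2)[OF yz(1)] by (simp add: orthogonal_def inner_commute)
  ultimately have "z = 0" using yz(3) by (simp add: inner_add_left)
  then show ?thesis using yz(1,3) span_eq_iff[THEN iffD2, OF assms(2)] by simp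
qed

section \<open>Tangent spaces in a slice chart\<close>

locale slice_chart =
  fixes M U V L :: "'a::euclidean_space set" and \<phi> \<psi> :: "'a \<Rightarrow> 'a"
  assumes diffeo: "diffeomorphism_between U V \<phi> \<psi>"
    and L: "subspace L"
    and slice: "\<phi> ` (U \<inter> M) = V \<inter> L"
begin

abbreviation D\<psi> :: "'a \<Rightarrow> 'a \<Rightarrow> 'a" where "D\<psi> y \<equiv> frechet_derivative \<psi> (at y)"

lemma
  shows open_U: "open U" and open_V: "open V"
    and smooth_\<phi>: "smooth_on \<phi> U" and smooth_\<psi>: "smooth_on \<psi> V"
    and \<psi>_\<phi>: "x \<in> U \<Longrightarrow> \<psi> (\<phi> x) = x" and \<phi>_\<psi>: "y \<in> V \<Longrightarrow> \<phi> (\<psi> y) = y"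
    and \<phi>_in_V: "x \<in> U \<Longrightarrow> \<phi> x \<in> V" and \<psi>_in_U: "y \<in> V \<Longrightarrow> \<psi> y \<in> U"
  using diffeo unfolding diffeomorphism_between_def by auto

lemma \<phi>_in_L: "x \<in> U \<Longrightarrow> x \<in> M \<Longrightarrow> \<phi> x \<in> L"
  using slice by blast

lemma \<psi>_in_M: "y \<in> V \<Longrightarrow> y \<in> L \<Longrightarrow> \<psi> y \<in> M"
  using slice \<psi>_\<phi> by (metis IntD1 IntD2 IntI imageE)

lemmas D\<psi> = smooth_on_has_derivative[OF smooth_\<psi>]
lemmas D\<phi> = smooth_on_has_derivative[OF smooth_\<phi>]

lemma linear_D\<psi>: "y \<in> V \<Longrightarrow> linear (D\<psi> y)"
  using D\<psi> has_derivative_linear by blast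

lemma D\<phi>_D\<psi>:
  assumes "y \<in> V" shows "frechet_derivative \<phi> (at (\<psi> y)) (D\<psi> y w) = w"
proof -
  have "(\<phi> \<circ> \<psi> has_derivative frechet_derivative \<phi> (at (\<psi> y)) \<circ> D\<psi> y) (at y)"
    by (intro diff_chain_at D\<psi> D\<phi> \<psi>_in_U assms)
  moreover have "(\<phi> \<circ> \<psi> has_derivative id) (at y)"
    by (rule has_derivative_transform_within_open[OF has_derivative_id open_V assms])
      (simp add: \<phi>_\<psi>)
  ultimately show ?thesis using has_derivative_unique by (metis comp_apply id_apply)
qed

lemma inj_D\<psi>: "y \<in> V \<Longrightarrow> inj (D\<psi> y)"
  using D\<phi>_D\<psi> by (metis injI)

lemma D\<psi>_D\<phi>:
  assumes "x \<in> U" shows "D\<psi> (\<phi> x) (frechet_derivative \<phi> (at x) w) = w"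
proof -
  have "(\<psi> \<circ> \<phi> has_derivative D\<psi> (\<phi> x) \<circ> frechet_derivative \<phi> (at x)) (at x)"
    by (intro diff_chain_at D\<psi> D\<phi> \<phi>_in_V assms)
  moreover have "(\<psi> \<circ> \<phi> has_derivative id) (at x)"
    by (rule has_derivative_transform_within_open[OF has_derivative_id open_U assms])
      (simp add: \<psi>_\<phi>)
  ultimately show ?thesis using has_derivative_unique by (metis comp_apply id_apply)
qed

text \<open>A curve in \<open>M\<close> is carried by \<open>\<phi>\<close> into \<open>L\<close>, so its velocity is too; conversely the vectors
\<open>D\<psi> w\<close> are velocities of the images of the straight lines in \<open>L\<close>.\<close>

lemma tangent_space_eq:
  assumes p: "p \<in> U" "p \<in> M"
  shows "tangent_space M p = D\<psi> (\<phi> p) ` L"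
proof (intro set_eqI iffI)
  fix v assume "v \<in> tangent_space M p"
  then obtain \<gamma> e where g: "0 < e" "smooth_on \<gamma> {-e<..<e}" "\<gamma> ` {-e<..<e} \<subseteq> M" "\<gamma> 0 = p"
    "(\<gamma> has_vector_derivative v) (at 0)"
    unfolding tangent_space_def by blast
  have "((\<phi> \<circ> \<gamma>) has_vector_derivative frechet_derivative \<phi> (at p) v) (at 0)"
    using has_vector_derivative_along_curve[of 1 \<gamma> UNIV p v \<phi>] g D\<phi>[OF p(1)] by simp
  moreover have "\<forall>\<^sub>F s in at 0. (\<phi> \<circ> \<gamma>) s \<in> L"
  proof -
    have "(\<gamma> \<longlongrightarrow> \<gamma> 0) (at 0)"
      using has_vector_derivative_continuous[OF g(5)] by (simp add: continuous_at)
    then have "\<forall>\<^sub>F s in at 0. \<gamma> s \<in> U"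
      using topological_tendstoD open_U g(4) p(1) by blast
    moreover have "\<forall>\<^sub>F s in at 0. s \<in> {-e<..<e}"
      using g(1) by (intro eventually_at_in_open') auto
    ultimately show ?thesis by eventually_elim (use g(3) \<phi>_in_L in \<open>auto simp: image_subset_iff\<close>)
  qed
  ultimately have "frechet_derivative \<phi> (at p) v \<in> L"
    using has_vector_derivative_in_subspace[OF _ L] \<phi>_in_L p g(4) by simp
  then show "v \<in> D\<psi> (\<phi> p) ` L" using D\<psi>_D\<phi>[OF p(1)] by (metis imageI)
next
  fix v assume "v \<in> D\<psi> (\<phi> p) ` L"
  then obtain w where w: "w \<in> L" "v = D\<psi> (\<phi> p) w" by blast
  have line: "((\<lambda>t. \<phi> p + t *\<^sub>R w) has_vector_derivative w) (at 0)"
    by (auto intro!: derivative_eq_intros)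
  have "open ((\<lambda>t. \<phi> p + t *\<^sub>R w) -` V)"
    by (intro open_vimage[OF open_V] continuous_intros)
  moreover have "0 \<in> (\<lambda>t. \<phi> p + t *\<^sub>R w) -` V" using \<phi>_in_V p by simp
  ultimately obtain e where e: "e > 0" "ball 0 e \<subseteq> (\<lambda>t. \<phi> p + t *\<^sub>R w) -` V" using openE by blast
  then have eV: "\<phi> p + t *\<^sub>R w \<in> V" if "t \<in> {-e<..<e}" for t :: real
    using that by (auto simp: subset_eq)
  have "\<phi> p + t *\<^sub>R w \<in> L" for t using \<phi>_in_L p w L by (simp add: subspace_add subspace_scale)
  then have "(\<lambda>t. \<psi> (\<phi> p + t *\<^sub>R w)) ` {-e<..<e} \<subseteq> M" using eV \<psi>_in_M by auto
  moreover have "smooth_on (\<lambda>t. \<psi> (\<phi> p + t *\<^sub>R w)) {-e<..<e}"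
    by (rule smooth_on_line[OF smooth_\<psi>]) (use eV in auto)
  moreover have "((\<lambda>t. \<psi> (\<phi> p + t *\<^sub>R w)) has_vector_derivative v) (at 0)"
    using has_vector_derivative_along_curve[of 1 "\<lambda>t. \<phi> p + t *\<^sub>R w" UNIV "\<phi> p" w \<psi>]
      line D\<psi>[OF \<phi>_in_V[OF p(1)]] w(2) by (simp add: o_def)
  moreover have "\<psi> (\<phi> p + 0 *\<^sub>R w) = p" using p \<psi>_\<phi> by simp
  ultimately show "v \<in> tangent_space M p"
    unfolding tangent_space_def using e(1) by blast
qed

lemma subspace_tangent_space:
  assumes "p \<in> U" "p \<in> M" shows "subspace (tangent_space M p)"
  using tangent_space_eq[OF assms] linear_D\<psi>[OF \<phi>_in_V] assms L by (simp add: linear_subspace_image)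

text \<open>In the chart the tangent spaces are spanned by the images under \<open>D\<psi>\<close> of a basis of \<open>L\<close>. This frame makes sense
on all of \<open>V\<close>, and the projection of \<open>d\<close> onto its span, composed with \<open>\<phi>\<close>, extends the
tangential part of \<open>d\<close> to a neighbourhood of \<open>p\<close>.\<close>

lemma tangent_part_differentiable:
  assumes "p \<in> U" "p \<in> M"
  shows "(\<lambda>q. tangent_part M q d) differentiable (at p within M)"
proof -
  obtain S where S: "S \<subseteq> L" "independent S" "L = span S"
    using basis_exists[of L] L span_subspace by metis
  have p: "\<phi> p \<in> V" using assms(1) \<phi>_in_V by simp
  have "\<exists>G. G differentiable (at (\<phi> p)) \<and>
    (\<forall>z. G z \<in> span (D\<psi> z ` S) \<and> (\<forall>b\<in>S. orthogonal (d - G z) (D\<psi> z b)))"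
    using smooth_on_has_derivative[OF smooth_on_directional_derivative[OF smooth_\<psi>] p] S(2) p
    by (intro differentiable_projection_onto_span[where g="\<lambda>_. d"] linear_D\<psi> inj_D\<psi>)
      (auto intro: finiteI_independent differentiableI)
  then obtain G where G: "G differentiable (at (\<phi> p))" "\<And>z. G z \<in> span (D\<psi> z ` S)"
    "\<And>z b. b \<in> S \<Longrightarrow> orthogonal (d - G z) (D\<psi> z b)" by blast
  have "(G \<circ> \<phi>) differentiable (at p)"
    using G(1) D\<phi>[OF assms(1)] differentiable_chain_at differentiableI by blast
  then obtain A where A: "(G \<circ> \<phi> has_derivative A) (at p within M)"
    using differentiable_def has_derivative_at_withinI by blast
  have eq: "tangent_part M q d = (G \<circ> \<phi>) q" if "q \<in> U \<inter> M" for q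
  proof (rule tangent_part_eqI)
    have q: "q \<in> U" "q \<in> M" using that by auto
    show "subspace (tangent_space M q)" using subspace_tangent_space q by blast
    have eq: "tangent_space M q = span (D\<psi> (\<phi> q) ` S)"
      using tangent_space_eq[OF q] S(3) linear_span_image[OF linear_D\<psi>[OF \<phi>_in_V[OF q(1)]]] by simp
    show "(G \<circ> \<phi>) q \<in> tangent_space M q" using eq G(2) by simp
    show "orthogonal (d - (G \<circ> \<phi>) q) w" if "w \<in> tangent_space M q" for w
      using that G(3) unfolding eq by (auto intro: orthogonal_to_span)
  qed
  have "((\<lambda>q. tangent_part M q d) has_derivative A) (at p within M)"
  proof (rule has_derivative_transform_eventually[OF A])
    show "\<forall>\<^sub>F q in at p within M. (G \<circ> \<phi>) q = tangent_part M q d"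
      using eventually_at_in_open'[OF open_U assms(1)] eq by (auto simp: eventually_at_filter elim: eventually_mono)
  qed (use eq assms in auto)
  then show ?thesis by (rule differentiableI)
qed

lemma tangent_part_props:
  assumes "p \<in> U" "p \<in> M"
  shows "tangent_part M p v \<in> tangent_space M p"
    and "w \<in> tangent_space M p \<Longrightarrow> orthogonal (v - tangent_part M p v) w"
proof -
  obtain y z where "y \<in> span (tangent_space M p)" "\<And>w. w \<in> span (tangent_space M p) \<Longrightarrow> orthogonal z w" "v = y + z"
    using orthogonal_subspace_decomp_exists by metis
  moreover have "span (tangent_space M p) = tangent_space M p"
    using subspace_tangent_space[OF assms] by simp
  ultimately have "tangent_part M p v = y" "y \<in> tangent_space M p"
    "\<And>w. w \<in> tangent_space M p \<Longrightarrow> orthogonal (v - y) w"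
    by (auto intro!: tangent_part_eqI subspace_tangent_space[OF assms])
  then show "tangent_part M p v \<in> tangent_space M p"
    "w \<in> tangent_space M p \<Longrightarrow> orthogonal (v - tangent_part M p v) w" by auto
qed

section \<open>Integral curves of the gradient of a height function\<close>

text \<open>The bound says that the gradient on \<open>M\<close> of the height function \<open>x \<mapsto> d \<bullet> x\<close> has length at most \<open>\<bar>c\<bar>\<close>
everywhere; \<open>D\<psi> y h\<close> is a unit vector in which it is attained. Transporting \<open>h\<close> along
the line \<open>y + t w\<close> by \<open>D\<psi>\<close> gives tangent vectors of \<open>M\<close>, so the defect \<open>F\<close> in the bound is nonnegative
and minimal at \<open>t = 0\<close>.\<close>

lemma directional_derivative_at_optimal_direction:
  assumes y: "y \<in> V" "y \<in> L" and h: "h \<in> L" and w: "w \<in> L"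
    and bound: "\<And>q v. q \<in> M \<Longrightarrow> v \<in> tangent_space M q \<Longrightarrow> (d \<bullet> v)\<^sup>2 \<le> c\<^sup>2 * (v \<bullet> v)"
    and optimal: "D\<psi> y h \<bullet> D\<psi> y h = 1" "d \<bullet> D\<psi> y h = c" and "c \<noteq> 0"
  shows "(d - c *\<^sub>R D\<psi> y h) \<bullet> frechet_derivative (\<lambda>z. D\<psi> z h) (at y) w = 0"
proof -
  define a1 where "a1 = frechet_derivative (\<lambda>z. D\<psi> z h) (at y) w"
  define F where "F t = c\<^sup>2 * (D\<psi> (y + t *\<^sub>R w) h \<bullet> D\<psi> (y + t *\<^sub>R w) h) - (d \<bullet> D\<psi> (y + t *\<^sub>R w) h)\<^sup>2" for t
  have line: "((\<lambda>t. y + t *\<^sub>R w) has_vector_derivative w) (at 0)"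
    by (auto intro!: derivative_eq_intros)
  have "((\<lambda>t. D\<psi> (y + t *\<^sub>R w) h) has_vector_derivative a1) (at 0)"
    using has_vector_derivative_along_curve[of 1 "\<lambda>t. y + t *\<^sub>R w" UNIV y w "\<lambda>z. D\<psi> z h"]
      line smooth_on_has_derivative[OF smooth_on_directional_derivative[OF smooth_\<psi>] y(1)]
    by (simp add: o_def a1_def)
  then have "(F has_derivative (\<lambda>t. t * (2 * c\<^sup>2 * (D\<psi> y h \<bullet> a1) - 2 * c * (d \<bullet> a1)))) (at 0)"
    unfolding F_def has_vector_derivative_def using optimal
    by (auto intro!: derivative_eq_intros simp: fun_eq_iff algebra_simps inner_commute power2_eq_square)
  then have F': "(F has_real_derivative 2 * c\<^sup>2 * (D\<psi> y h \<bullet> a1) - 2 * c * (d \<bullet> a1)) (at 0)"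
    by (simp add: has_field_derivative_def mult_commute_abs)
  have "open ((\<lambda>t. y + t *\<^sub>R w) -` V)"
    by (intro open_vimage[OF open_V] continuous_intros)
  moreover have "0 \<in> (\<lambda>t. y + t *\<^sub>R w) -` V" using y by simp
  ultimately obtain e where e: "e > 0" "ball 0 e \<subseteq> (\<lambda>t. y + t *\<^sub>R w) -` V" using openE by blast
  have "F 0 \<le> F t" if "\<bar>0 - t\<bar> < e" for t
  proof -
    have V: "y + t *\<^sub>R w \<in> V" using that e by (auto simp: subset_eq)
    have "y + t *\<^sub>R w \<in> L" using y w L by (simp add: subspace_add subspace_scale)
    then have M: "\<psi> (y + t *\<^sub>R w) \<in> M" using V \<psi>_in_M by blast
    then have "D\<psi> (y + t *\<^sub>R w) h \<in> tangent_space M (\<psi> (y + t *\<^sub>R w))"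
      using tangent_space_eq[OF \<psi>_in_U[OF V] M] h \<phi>_\<psi>[OF V] by simp
    then have "F t \<ge> 0" using bound[OF M] by (simp add: F_def)
    then show ?thesis using optimal by (simp add: F_def)
  qed
  then have "2 * c\<^sup>2 * (D\<psi> y h \<bullet> a1) - 2 * c * (d \<bullet> a1) = 0"
    using DERIV_local_min[OF F' e(1)] by blast
  then have "c * (c * (D\<psi> y h \<bullet> a1) - d \<bullet> a1) = 0" by (simp add: algebra_simps power2_eq_square)
  then show ?thesis using \<open>c \<noteq> 0\<close> by (simp add: a1_def algebra_simps)
qed

text \<open>The geodesic property of \<open>\<alpha>\<close>, whose velocity is the normalized gradient of the height function. Differentiating
the relation \<open>grad\<close> along \<open>\<alpha>\<close>, with \<open>v = D\<psi> w\<close> for a fixed \<open>w \<in> L\<close>, expresses \<open>a \<bullet> v\<close> by the second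
derivative of \<open>\<psi>\<close> in the directions \<open>h\<close> and \<open>w\<close>; after exchanging them the optimality of \<open>\<alpha>'\<close> makes it vanish.\<close>

lemma acceleration_normal:
  assumes I: "open I" "s \<in> I" and "\<alpha> s \<in> U"
    and \<alpha>: "\<And>t. t \<in> I \<Longrightarrow> \<alpha> t \<in> M" "\<And>t. t \<in> I \<Longrightarrow> (\<alpha> has_vector_derivative \<alpha>' t) (at t)"
    and \<alpha>': "(\<alpha>' has_vector_derivative a) (at s)"
    and grad: "\<And>t v. t \<in> I \<Longrightarrow> v \<in> tangent_space M (\<alpha> t) \<Longrightarrow> c * (\<alpha>' t \<bullet> v) = d \<bullet> v"
    and tangent: "\<alpha>' s \<in> tangent_space M (\<alpha> s)" "norm (\<alpha>' s) = 1"
    and bound: "\<And>q v. q \<in> M \<Longrightarrow> v \<in> tangent_space M q \<Longrightarrow> (d \<bullet> v)\<^sup>2 \<le> c\<^sup>2 * (v \<bullet> v)"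
    and "c \<noteq> 0" and v: "v \<in> tangent_space M (\<alpha> s)"
  shows "orthogonal a v"
proof -
  define y where "y = \<phi> (\<alpha> s)"
  have y: "y \<in> V" "y \<in> L" using assms(3) \<alpha>(1)[OF I(2)] \<phi>_in_V \<phi>_in_L by (auto simp: y_def)
  have TM: "tangent_space M (\<alpha> s) = D\<psi> y ` L"
    unfolding y_def using tangent_space_eq assms(3) \<alpha>(1)[OF I(2)] by blast
  obtain h where h: "h \<in> L" "\<alpha>' s = D\<psi> y h" using tangent TM by blast
  obtain w where w: "w \<in> L" "v = D\<psi> y w" using v TM by blast
  have y': "frechet_derivative \<phi> (at (\<alpha> s)) (\<alpha>' s) = h"
    using D\<phi>_D\<psi>[OF y(1), of h] h(2) \<psi>_\<phi>[OF assms(3)] by (simp add: y_def)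
  define b where "b = frechet_derivative (\<lambda>z. D\<psi> z w) (at y) h"
  have "(\<phi> \<circ> \<alpha> has_derivative frechet_derivative \<phi> (at (\<alpha> s)) \<circ> (\<lambda>t. t *\<^sub>R \<alpha>' s)) (at s)"
    using \<alpha>(2)[OF I(2)] D\<phi>[OF assms(3)] unfolding has_vector_derivative_def by (rule diff_chain_at)
  from diff_chain_at[OF this, of "\<lambda>z. D\<psi> z w"]
  have "((\<lambda>z. D\<psi> z w) \<circ> (\<phi> \<circ> \<alpha>) has_derivative
      frechet_derivative (\<lambda>z. D\<psi> z w) (at y) \<circ> (frechet_derivative \<phi> (at (\<alpha> s)) \<circ> (\<lambda>t. t *\<^sub>R \<alpha>' s))) (at s)"
    using smooth_on_has_derivative[OF smooth_on_directional_derivative[OF smooth_\<psi>] y(1)]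
    by (simp add: y_def)
  moreover have "frechet_derivative (\<lambda>z. D\<psi> z w) (at y) \<circ> (frechet_derivative \<phi> (at (\<alpha> s)) \<circ> (\<lambda>t. t *\<^sub>R \<alpha>' s))
      = (\<lambda>t. t *\<^sub>R b)"
    using linear_scale[OF has_derivative_linear[OF D\<phi>[OF assms(3)]]] y'
      linear_scale[OF has_derivative_linear[OF smooth_on_has_derivative[OF smooth_on_directional_derivative[OF smooth_\<psi>] y(1)]]]
    by (simp add: fun_eq_iff b_def)
  ultimately have W: "((\<lambda>t. D\<psi> (\<phi> (\<alpha> t)) w) has_vector_derivative b) (at s)"
    by (simp add: has_vector_derivative_def o_def)
  \<comment> \<open>The relation \<open>grad\<close> for the field \<open>D\<psi> w\<close>, which is tangent to \<open>M\<close> along \<open>\<alpha>\<close>.\<close>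
  define g where "g t = c * (\<alpha>' t \<bullet> D\<psi> (\<phi> (\<alpha> t)) w) - d \<bullet> D\<psi> (\<phi> (\<alpha> t)) w" for t
  have "(g has_vector_derivative c * (\<alpha>' s \<bullet> b + a \<bullet> v) - d \<bullet> b) (at s)"
    using W \<alpha>' unfolding g_def has_vector_derivative_def
    by (auto intro!: derivative_eq_intros simp: fun_eq_iff algebra_simps y_def[symmetric] w(2))
  moreover have "(g has_vector_derivative 0) (at s)"
    unfolding has_vector_derivative_def
  proof (rule has_derivative_transform_eventually)
    have g0: "0 = g t" if "t \<in> I" "\<alpha> t \<in> U" for t
    proof -
      have "D\<psi> (\<phi> (\<alpha> t)) w \<in> tangent_space M (\<alpha> t)"
        using tangent_space_eq \<alpha>(1) that w(1) by blast
      then show ?thesis using grad[OF that(1)] by (simp add: g_def)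
    qed
    have "(\<alpha> \<longlongrightarrow> \<alpha> s) (at s)"
      using has_vector_derivative_continuous[OF \<alpha>(2)[OF I(2)]] by (simp add: continuous_at)
    then have "\<forall>\<^sub>F t in at s. \<alpha> t \<in> U"
      using topological_tendstoD open_U assms(3) by blast
    moreover have "\<forall>\<^sub>F t in at s. t \<in> I" using I by (intro eventually_at_in_open') auto
    ultimately show "\<forall>\<^sub>F t in at s. 0 = g t" by eventually_elim (rule g0)
    show "0 = g s" using g0 I assms(3) by blast
    show "((\<lambda>_. 0) has_derivative (\<lambda>x. x *\<^sub>R (0::real))) (at s)" by simp
  qed simp
  ultimately have eq: "c * (\<alpha>' s \<bullet> b + a \<bullet> v) - d \<bullet> b = 0" using vector_derivative_unique_at by blast
  have "D\<psi> y h \<bullet> D\<psi> y h = 1" using tangent(2) h(2) by (simp add: norm_eq_1)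
  moreover have "d \<bullet> D\<psi> y h = c"
    using grad[OF I(2) tangent(1)] tangent(2) h(2) by (simp add: norm_eq_1)
  ultimately have "(d - c *\<^sub>R D\<psi> y h) \<bullet> frechet_derivative (\<lambda>z. D\<psi> z h) (at y) w = 0"
    by (intro directional_derivative_at_optimal_direction[OF y h(1) w(1)] bound \<open>c \<noteq> 0\<close>)
  moreover have "frechet_derivative (\<lambda>z. D\<psi> z h) (at y) w = b"
    unfolding b_def by (rule frechet_derivative_symmetric[OF open_V smooth_\<psi> y(1)])
  ultimately have "d \<bullet> b = c * (\<alpha>' s \<bullet> b)" using h(2) by (simp add: inner_diff_left)
  then have "c * (a \<bullet> v) = 0" using eq by (simp add: algebra_simps)
  then show ?thesis using \<open>c \<noteq> 0\<close> by (simp add: orthogonal_def)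
qed

end

section \<open>Helix submanifolds\<close>

lemma smooth_submanifold_slice_chart:
  assumes "smooth_submanifold m M" "p \<in> M"
  obtains U V L \<phi> \<psi> where "slice_chart M U V L \<phi> \<psi>" "p \<in> U"
  using assms unfolding smooth_submanifold_def slice_chart_def by blast

text \<open>As \<open>d\<close> is a unit vector, \<open>d \<bullet> P = \<parallel>P\<parallel>\<^sup>2\<close> for its tangential part \<open>P\<close>, so the angle with the tangent space is
\<open>arccos \<parallel>P\<parallel>\<close>. An angle below \<open>\<pi>/2\<close> makes the constant positive.\<close>

lemma helix_norm_tangent_part:
  assumes M: "smooth_submanifold m M" and "helix M d"
  obtains c where "0 < c" "\<And>q. q \<in> M \<Longrightarrow> norm (tangent_part M q d) = c"
proof -
  obtain \<theta> where \<theta>: "0 < \<theta>" "\<theta> < pi / 2" "\<And>q. q \<in> M \<Longrightarrow> angle_with_tangent_space M q d = \<theta>"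
    and d: "norm d = 1"
    using assms(2) unfolding helix_def by blast
  have "norm (tangent_part M q d) = cos \<theta>" if q: "q \<in> M" for q
  proof -
    obtain U V L \<phi> \<psi> where "slice_chart M U V L \<phi> \<psi>" "q \<in> U"
      using smooth_submanifold_slice_chart[OF M q] .
    then interpret slice_chart M U V L \<phi> \<psi> by simp
    define P where "P = tangent_part M q d"
    have "orthogonal (d - P) P" using tangent_part_props[OF \<open>q \<in> U\<close> q] by (simp add: P_def)
    then have dP: "d \<bullet> P = norm P * norm P"
      by (simp add: orthogonal_def inner_diff_left power2_norm_eq_inner[symmetric] power2_eq_square)
    have "norm P * norm P \<le> 1 * norm P" using norm_cauchy_schwarz[of d P] d dP by simp
    then have le1: "norm P \<le> 1" by (cases "P = 0") auto
    have "arccos (norm P) = \<theta>"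
      using \<theta>(3)[OF q] dP d unfolding angle_with_tangent_space_def P_def by (cases "P = 0") (auto simp: P_def)
    then show ?thesis using le1 cos_arccos[of "norm P"] unfolding P_def
      by (simp add: order_trans[of "-1" 0])
  qed
  moreover have "0 < cos \<theta>" using \<theta> by (intro cos_gt_zero) auto
  ultimately show ?thesis using that by blast
qed

theorem theorem3p2:
  fixes M :: "(real ^ 'n) set" and d :: "nat \<Rightarrow> real ^ 'n" and m r j :: nat
    and I :: "real set" and \<alpha> :: "real \<Rightarrow> real ^ 'n" and k :: "real \<Rightarrow> real"
    and T :: "real ^ 'n \<Rightarrow> real ^ 'n"
  assumes "smooth_submanifold m M"
    and "weak_helix r M d"
    and "j \<in> {1..r}"
    and "T = unit_tangent_component M (d j)"
    and "integral_curve M T I \<alpha>"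
    and "unit_speed I \<alpha>"
    and "first_curvature I \<alpha> k"
  shows "\<forall>s\<in>I. norm (second_fundamental_form M T T (\<alpha> s)) = \<bar>k s\<bar>"
proof
  fix s assume s: "s \<in> I"
  have "helix M (d j)" using assms(2,3) by (simp add: weak_helix_def)
  then obtain c where c: "0 < c" "\<And>q. q \<in> M \<Longrightarrow> norm (tangent_part M q (d j)) = c"
    using helix_norm_tangent_part[OF assms(1)] by blast
  have T: "T q = tangent_part M q (d j) /\<^sub>R c" if "q \<in> M" for q
    using c(2)[OF that] by (simp add: assms(4) unit_tangent_component_def)
  have I: "open I" and \<alpha>M: "\<And>t. t \<in> I \<Longrightarrow> \<alpha> t \<in> M"
    and \<alpha>: "\<And>t. t \<in> I \<Longrightarrow> (\<alpha> has_vector_derivative T (\<alpha> t)) (at t)"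
    using assms(5) by (auto simp: integral_curve_def)
  obtain N where N: "norm (N s) = 1"
    "((\<lambda>t. vector_derivative \<alpha> (at t)) has_vector_derivative k s *\<^sub>R N s) (at s)"
    using assms(7) s unfolding first_curvature_def by blast
  \<comment> \<open>The first Frenet equation, read as the derivative of \<open>T\<close> along \<open>\<alpha>\<close>.\<close>
  have acc: "((\<lambda>t. T (\<alpha> t)) has_vector_derivative k s *\<^sub>R N s) (at s)"
    by (rule has_vector_derivative_transform_within_open[OF N(2) I s])
      (use \<alpha> vector_derivative_at in blast)
  have proj: "tangent_part M q (d j) \<in> tangent_space M q"
    "\<And>v. v \<in> tangent_space M q \<Longrightarrow> d j \<bullet> v = tangent_part M q (d j) \<bullet> v"
    "subspace (tangent_space M q)" if q: "q \<in> M" for q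
  proof -
    obtain U V L \<phi> \<psi> where "slice_chart M U V L \<phi> \<psi>" "q \<in> U"
      using smooth_submanifold_slice_chart[OF assms(1) q] .
    then interpret slice_chart M U V L \<phi> \<psi> by simp
    show "tangent_part M q (d j) \<in> tangent_space M q" "subspace (tangent_space M q)"
      "\<And>v. v \<in> tangent_space M q \<Longrightarrow> d j \<bullet> v = tangent_part M q (d j) \<bullet> v"
      using tangent_part_props[OF \<open>q \<in> U\<close> q, where v="d j"] subspace_tangent_space[OF \<open>q \<in> U\<close> q]
      by (auto simp: orthogonal_def inner_diff_left)
  qed
  have T_tangent: "T q \<in> tangent_space M q" if "q \<in> M" for q
    using T proj(1,3) that by (simp add: subspace_scale)
  have bound: "(d j \<bullet> v)\<^sup>2 \<le> c\<^sup>2 * (v \<bullet> v)" if "q \<in> M" "v \<in> tangent_space M q" for q v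
    using Cauchy_Schwarz_ineq[of "tangent_part M q (d j)" v] proj(2)[OF that] c(2)[OF that(1)]
    by (simp add: power2_norm_eq_inner[symmetric])
  have grad: "c * (T (\<alpha> t) \<bullet> v) = d j \<bullet> v" if "t \<in> I" "v \<in> tangent_space M (\<alpha> t)" for t v
    using proj(2)[OF \<alpha>M that(2)] that(1) T[OF \<alpha>M[OF that(1)]] c(1) by simp
  obtain U V L \<phi> \<psi> where "slice_chart M U V L \<phi> \<psi>" and U: "\<alpha> s \<in> U"
    using smooth_submanifold_slice_chart[OF assms(1) \<alpha>M[OF s]] .
  then interpret slice_chart M U V L \<phi> \<psi> by simp
  have unit: "norm (T (\<alpha> s)) = 1" using T[OF \<alpha>M[OF s]] c(1) c(2)[OF \<alpha>M[OF s]] by simp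
  have normal: "orthogonal (k s *\<^sub>R N s) v" if "v \<in> tangent_space M (\<alpha> s)" for v
    by (rule acceleration_normal[OF I s U \<alpha>M \<alpha> acc grad T_tangent[OF \<alpha>M[OF s]] unit bound _ that])
      (use c(1) in auto)
  \<comment> \<open>Differentiability of \<open>T\<close> within \<open>M\<close> lets the chain rule identify \<open>D\<^sub>T T\<close> with the derivative of \<open>T\<close> along \<open>\<alpha>\<close>.\<close>
  have "(\<lambda>q. tangent_part M q (d j) /\<^sub>R c) differentiable (at (\<alpha> s) within M)"
    using tangent_part_differentiable[OF U \<alpha>M[OF s]] by (intro differentiable_scaleR) auto
  then obtain A where "((\<lambda>q. tangent_part M q (d j) /\<^sub>R c) has_derivative A) (at (\<alpha> s) within M)"
    unfolding differentiable_def by blast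
  from has_derivative_transform[OF \<alpha>M[OF s] T this]
  have "(T has_derivative A) (at (\<alpha> s) within M)" .
  then have "T differentiable (at (\<alpha> s) within M)" by (rule differentiableI)
  then have D: "(T has_derivative frechet_derivative T (at (\<alpha> s) within M)) (at (\<alpha> s) within M)"
    using frechet_derivative_works by blast
  have "(T has_derivative frechet_derivative T (at (\<alpha> s) within M)) (at (\<alpha> s) within \<alpha> ` I)"
    using has_derivative_subset[OF D] \<alpha>M by blast
  moreover have "(\<alpha> has_derivative (\<lambda>t. t *\<^sub>R T (\<alpha> s))) (at s within I)"
    using \<alpha>[OF s] has_derivative_at_withinI unfolding has_vector_derivative_def by blast
  ultimately have "(T \<circ> \<alpha> has_derivative
      frechet_derivative T (at (\<alpha> s) within M) \<circ> (\<lambda>t. t *\<^sub>R T (\<alpha> s))) (at s within I)"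
    by (intro diff_chain_within)
  then have "((\<lambda>t. T (\<alpha> t)) has_vector_derivative covariant_deriv M T T (\<alpha> s)) (at s)"
    using linear_scale[OF has_derivative_linear[OF D]] at_within_open[OF s I]
    by (simp add: has_vector_derivative_def covariant_deriv_def o_def)
  then have cov: "covariant_deriv M T T (\<alpha> s) = k s *\<^sub>R N s"
    using acc vector_derivative_unique_at by blast
  have "tangent_part M (\<alpha> s) (k s *\<^sub>R N s) = 0"
    by (rule tangent_part_eqI) (use normal proj(3)[OF \<alpha>M[OF s]] subspace_0 in auto)
  then show "norm (second_fundamental_form M T T (\<alpha> s)) = \<bar>k s\<bar>"
    using cov N(1) by (simp add: second_fundamental_form_def riemannian_connection_def)
qed

end
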